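(* Let $c,k,a_2$ be real constants. The map $\varphi:(M^2,dr^2+\sigma^2(r)d\theta^2)\to(N^2,d\rho^2+\lambda^2(\rho)d\phi^2)$ given by $\varphi(r,\theta)=(\rho(r),\,cr+k\theta+a_2)$ is biharmonic if and only if $\rho=\rho(r)$ solves the system $$\begin{cases} x''+\frac{\sigma'}{\sigma}x'-\left(c^2+\frac{k^2}{\sigma^2}\right)(\lambda\lambda')'(\rho)\,x-(2cy'+y^2)\,(\lambda\lambda')(\rho)=0,\\[2pt] cy''+yy'+\frac{2c^2\lambda'(\rho)}{\lambda(\rho)}x'+2c^2\left(\frac{\sigma'\lambda'(\rho)}{\sigma\lambda(\rho)}+\frac{\rho'\,(\lambda\lambda')'(\rho)}{\lambda^2(\rho)}\right)x=0, \end{cases}$$ where $$x=\tau^1=\rho''+\frac{\sigma'}{\sigma}\rho'-\left(c^2+\frac{k^2}{\sigma^2}\right)(\lambda\lambda')(\rho),\qquad y=\tau^2=\frac{2c\rho'\lambda'(\rho)}{\lambda(\rho)}+\frac{c\sigma'}{\sigma}$$ are the components of the tension field of $\varphi$ with respect to $\partial_\rho,\partial_\phi$.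
   Context: All objects are smooth. $M^2$ is a rotationally symmetric surface with coordinates $(r,\theta)$, $r$ in an open interval $I$, and metric $dr^2+\sigma^2(r)d\theta^2$ with $\sigma>0$ on $I$; $N^2$ is a rotationally symmetric surface with coordinates $(\rho,\phi)$, $\rho$ in an open interval $J$, and metric $d\rho^2+\lambda^2(\rho)d\phi^2$ with $\lambda>0$ on $J$. Maps are given by their expressions in these coordinates, with $\rho:I\to J$, and biharmonicity is considered on the coordinate domain. Primes on $\sigma,\rho,x,y$ denote $d/dr$; $\lambda'(\rho)$, $(\lambda\lambda')(\rho)$, $(\lambda\lambda')'(\rho)$ denote the functions $\frac{d\lambda}{d\rho}$, $\lambda\frac{d\lambda}{d\rho}$, $\frac{d}{d\rho}\left(\lambda\frac{d\lambda}{d\rho}\right)$ evaluated at $\rho=\rho(r)$. The tension field of a map $\varphi:(M,g)\to(N,h)$ is $\tau(\varphi)=\mathrm{Tr}_g\nabla d\varphi$; $\varphi$ is harmonic if $\tau(\varphi)=0$. The map $\varphi$ is biharmonic if its bitension field vanishes: $\tau_2(\varphi)=\mathrm{Tr}_g(\nabla^\varphi\nabla^\varphi-\nabla^\varphi_{\nabla^M})\tau(\varphi)-\mathrm{Tr}_gR^N(d\varphi,\tau(\varphi))d\varphi=0$, where $R^N(X,Y)Z=[\nabla^N_X,\nabla^N_Y]Z-\nabla^N_{[X,Y]}Z$. *)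

theory Defs
  imports "HOL-Analysis.Analysis"
begin

(* For open I, differentiability of all iterated derivatives on I is C^infinity regularity on I. *)
definition smooth_on :: "real set \<Rightarrow> (real \<Rightarrow> real) \<Rightarrow> bool" where
  "smooth_on I f \<longleftrightarrow> (\<forall>n. \<forall>t\<in>I. (deriv ^^ n) f field_differentiable (at t))"

(* A metric on an open set of real^'n is given by its matrix of components in the coordinates,
   a vector field (and a vector field along a map) by its components in the coordinate frame. *)

type_synonym 'n metric = "real^'n \<Rightarrow> real^'n^'n"
type_synonym ('m, 'n) field_along = "real^'m \<Rightarrow> real^'n"
type_synonym 'n vfield = "('n, 'n) field_along"

definition frame :: "'n::finite \<Rightarrow> 'n vfield" where
  "frame i = (\<lambda>p. axis i 1)"

definition dir_deriv :: "(real^'m::finite \<Rightarrow> real^'n::finite) \<Rightarrow> 'm vfield \<Rightarrow> ('m, 'n) field_along" where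
  "dir_deriv F X = (\<lambda>p. frechet_derivative F (at p) (X p))"

definition metric_partial :: "'n::finite metric \<Rightarrow> 'n \<Rightarrow> 'n \<Rightarrow> 'n \<Rightarrow> real^'n \<Rightarrow> real" where
  "metric_partial g l i j p = frechet_derivative (\<lambda>q. g q $ i $ j) (at p) (axis l 1)"

definition christoffel :: "'n::finite metric \<Rightarrow> 'n \<Rightarrow> 'n \<Rightarrow> 'n \<Rightarrow> real^'n \<Rightarrow> real" where
  "christoffel g a i j p =
     (\<Sum>l\<in>UNIV. matrix_inv (g p) $ a $ l *
        (metric_partial g i j l p + metric_partial g j i l p - metric_partial g l i j p)) / 2"

definition chris_form :: "'n::finite metric \<Rightarrow> real^'n \<Rightarrow> real^'n \<Rightarrow> real^'n \<Rightarrow> real^'n" where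
  "chris_form g p u v = (\<chi> a. \<Sum>i\<in>UNIV. \<Sum>j\<in>UNIV. christoffel g a i j p * u $ i * v $ j)"

definition nabla :: "'n::finite metric \<Rightarrow> 'n vfield \<Rightarrow> 'n vfield \<Rightarrow> 'n vfield" where
  "nabla g X Y = (\<lambda>p. dir_deriv Y X p + chris_form g p (X p) (Y p))"

definition lie_bracket :: "'n::finite vfield \<Rightarrow> 'n vfield \<Rightarrow> 'n vfield" where
  "lie_bracket X Y = (\<lambda>p. dir_deriv Y X p - dir_deriv X Y p)"

definition curvature :: "'n::finite metric \<Rightarrow> 'n vfield \<Rightarrow> 'n vfield \<Rightarrow> 'n vfield \<Rightarrow> 'n vfield" where
  "curvature g X Y Z = (\<lambda>p. nabla g X (nabla g Y Z) p - nabla g Y (nabla g X Z) p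
                            - nabla g (lie_bracket X Y) Z p)"

(* The curvature is tensorial, so its value on tangent vectors at p may be computed with any
   extensions to vector fields; the extensions with constant components are used. *)
definition curvature_at :: "'n::finite metric \<Rightarrow> real^'n \<Rightarrow> real^'n \<Rightarrow> real^'n \<Rightarrow> real^'n \<Rightarrow> real^'n" where
  "curvature_at g p u v w = curvature g (\<lambda>_. u) (\<lambda>_. v) (\<lambda>_. w) p"

(* The connection induced by nabla h on fields along f, in the direction of a field X on the source.
   The differential of f applied to X is the field dir_deriv f X along f. *)
definition pull_nabla ::
  "'n::finite metric \<Rightarrow> (real^'m::finite \<Rightarrow> real^'n) \<Rightarrow> 'm vfield \<Rightarrow> ('m, 'n) field_along \<Rightarrow> ('m, 'n) field_along"
  where
  "pull_nabla h f X V = (\<lambda>p. dir_deriv V X p + chris_form h (f p) (dir_deriv f X p) (V p))"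

definition metric_trace ::
  "'m::finite metric \<Rightarrow> ('m vfield \<Rightarrow> 'm vfield \<Rightarrow> ('m, 'n::finite) field_along) \<Rightarrow> ('m, 'n) field_along"
  where
  "metric_trace g B = (\<lambda>p. \<Sum>i\<in>UNIV. \<Sum>j\<in>UNIV. matrix_inv (g p) $ i $ j *\<^sub>R B (frame i) (frame j) p)"

definition second_fundamental_form ::
  "'m::finite metric \<Rightarrow> 'n::finite metric \<Rightarrow> (real^'m \<Rightarrow> real^'n) \<Rightarrow> 'm vfield \<Rightarrow> 'm vfield
     \<Rightarrow> ('m, 'n) field_along" where
  "second_fundamental_form g h f X Y =
     (\<lambda>p. pull_nabla h f X (dir_deriv f Y) p - dir_deriv f (nabla g X Y) p)"

definition tension ::
  "'m::finite metric \<Rightarrow> 'n::finite metric \<Rightarrow> (real^'m \<Rightarrow> real^'n) \<Rightarrow> ('m, 'n) field_along" where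
  "tension g h f = metric_trace g (second_fundamental_form g h f)"

definition bitension ::
  "'m::finite metric \<Rightarrow> 'n::finite metric \<Rightarrow> (real^'m \<Rightarrow> real^'n) \<Rightarrow> ('m, 'n) field_along" where
  "bitension g h f = (\<lambda>p.
     metric_trace g (\<lambda>X Y q. pull_nabla h f X (pull_nabla h f Y (tension g h f)) q
                             - pull_nabla h f (nabla g X Y) (tension g h f) q) p
     - metric_trace g (\<lambda>X Y q. curvature_at h (f q) (dir_deriv f X q) (tension g h f q) (dir_deriv f Y q)) p)"

definition biharmonic_on ::
  "(real^'m::finite) set \<Rightarrow> 'm metric \<Rightarrow> 'n::finite metric \<Rightarrow> (real^'m \<Rightarrow> real^'n) \<Rightarrow> bool" where
  "biharmonic_on U g h f \<longleftrightarrow> (\<forall>p\<in>U. bitension g h f p = 0)"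

(* The first coordinate is the radial one, the second the angular one, taken to range over the
   whole line (the universal cover of the circle), so that no periodicity constraint arises. *)

definition rot_domain :: "real set \<Rightarrow> (real^2) set" where
  "rot_domain I = {p. p $ 1 \<in> I}"

definition rot_metric :: "(real \<Rightarrow> real) \<Rightarrow> 2 metric" where
  "rot_metric s = (\<lambda>p. vector [vector [1, 0], vector [0, (s (p $ 1))\<^sup>2]])"

end

theory Submission
  imports Defs
begin

text \<open>
  Every field that enters the tension and bitension fields of
  \<open>\<phi>(r, \<theta>) = (\<rho>(r), c r + k \<theta> + a\<^sub>2)\<close> has components depending on \<open>r\<close> alone: the differential of
  \<open>\<phi>\<close> has the columns \<open>(\<rho>', c)\<close> and \<open>(0, k)\<close>, and the covariant derivative along \<open>\<phi>\<close> of a radial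
  field in a coordinate direction is radial (\<open>pull_nabla_radial\<close>). So all covariant derivatives along \<open>\<phi>\<close> are
  ordinary derivatives in \<open>r\<close> corrected by the Christoffel symbols \<open>- \<lambda>\<lambda>'\<close> and \<open>\<lambda>' / \<lambda>\<close> of the target.
  One application to the differential gives the tension field \<open>(x, y)\<close> (\<open>tension_eq\<close>). Two
  applications to \<open>(x, y)\<close>, together with the curvature term governed by \<open>K = - \<lambda>'' / \<lambda>\<close>
  (\<open>curvature_at_rot_metric\<close>), give the bitension field (\<open>bitension_eq\<close>).

  Its first component is the left-hand side of the first equation. Its second component \<open>T\<close> contains
  the product \<open>(\<lambda>' / \<lambda>) x y\<close>, and after inserting the formula for \<open>y\<close> there, the left-hand side of the
  second equation turns out to be \<open>c T\<close>. The factor is harmless: if \<open>c = 0\<close> then \<open>y\<close> vanishes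
  identically and so does \<open>T\<close> (\<open>angular_bitension_eq_0_iff\<close>).
\<close>

section \<open>Calculus of smooth functions of one variable\<close>
text \<open>
  Closure of \<open>smooth_on\<close> under products, quotients and compositions is proved by induction on
  the number of derivatives. The recursion peels off the innermost derivative, so that the induction
  hypothesis applies to the functions occurring in the product, quotient or chain rule.
\<close>
primrec times_differentiable_on :: "nat \<Rightarrow> real set \<Rightarrow> (real \<Rightarrow> real) \<Rightarrow> bool" where
  "times_differentiable_on 0 I f \<longleftrightarrow> True"
| "times_differentiable_on (Suc n) I f \<longleftrightarrow>
     (\<forall>t\<in>I. f field_differentiable (at t)) \<and> times_differentiable_on n I (deriv f)"

lemma times_differentiable_on_iff_funpow:
  "times_differentiable_on n I f \<longleftrightarrow> (\<forall>m<n. \<forall>t\<in>I. (deriv ^^ m) f field_differentiable (at t))"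
proof (induction n arbitrary: f)
  case (Suc n)
  have "times_differentiable_on (Suc n) I f \<longleftrightarrow>
      (\<forall>t\<in>I. f field_differentiable (at t)) \<and>
      (\<forall>m<n. \<forall>t\<in>I. (deriv ^^ m) (deriv f) field_differentiable (at t))"
    by (simp only: times_differentiable_on.simps Suc.IH)
  also have "\<dots> \<longleftrightarrow> (\<forall>m<Suc n. \<forall>t\<in>I. (deriv ^^ m) f field_differentiable (at t))"
    by (simp only: All_less_Suc2 funpow_Suc_right o_apply funpow_0)
  finally show ?case .
qed simp

lemma smooth_on_iff_times_differentiable_on:
  "smooth_on I f \<longleftrightarrow> (\<forall>n. times_differentiable_on n I f)"
  unfolding smooth_on_def times_differentiable_on_iff_funpow by blast

lemma times_differentiable_on_SucD:
  "times_differentiable_on (Suc n) I f \<Longrightarrow> times_differentiable_on n I f"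
  unfolding times_differentiable_on_iff_funpow by auto

text \<open>
  Iterated derivatives on an open set only see the values there. Thus a function such as \<open>1 / \<sigma>\<close>,
  which is meaningful on the coordinate interval only, can be handled by its formula on that interval.
\<close>
lemma times_differentiable_on_cong:
  assumes "open I" "\<And>t. t \<in> I \<Longrightarrow> f t = g t"
  shows "times_differentiable_on n I f \<longleftrightarrow> times_differentiable_on n I g"
  using assms(2)
proof (induction n arbitrary: f g)
  case (Suc n)
  have ev: "eventually (\<lambda>u. f u = g u) (nhds t)" if "t \<in> I" for t
    using assms(1) that Suc.prems eventually_nhds by blast
  have "f field_differentiable (at t) \<longleftrightarrow> g field_differentiable (at t)" if "t \<in> I" for t
    unfolding field_differentiable_def
    using DERIV_cong_ev[OF refl ev[OF that] refl] by blast
  moreover have "deriv f t = deriv g t" if "t \<in> I" for t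
    by (rule deriv_cong_ev[OF ev[OF that] refl])
  ultimately show ?case
    using Suc.IH[of "deriv f" "deriv g"] by simp
qed simp

lemma times_differentiable_on_SucI:
  assumes "open I" "\<And>t. t \<in> I \<Longrightarrow> (f has_real_derivative f' t) (at t)"
    and "times_differentiable_on n I f'"
  shows "times_differentiable_on (Suc n) I f"
proof -
  have "deriv f t = f' t" if "t \<in> I" for t
    using assms(2)[OF that] by (rule DERIV_imp_deriv)
  then have "times_differentiable_on n I (deriv f)"
    using times_differentiable_on_cong[OF assms(1)] assms(3) by blast
  then show ?thesis
    using assms(2) by (auto simp: field_differentiable_def)
qed

lemma times_differentiable_on_Suc_imp_DERIV:
  assumes "times_differentiable_on (Suc n) I f" "t \<in> I"
  shows "(f has_real_derivative deriv f t) (at t)"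
  using assms by (simp add: DERIV_deriv_iff_field_differentiable)

lemma times_differentiable_on_const:
  assumes "open I" shows "times_differentiable_on n I (\<lambda>_. a)"
proof (induction n arbitrary: a)
  case (Suc n)
  show ?case
    by (rule times_differentiable_on_SucI[OF assms _ Suc.IH[of 0]]) (auto intro!: derivative_eq_intros)
qed simp

lemma times_differentiable_on_add:
  assumes "open I" "times_differentiable_on n I f" "times_differentiable_on n I g"
  shows "times_differentiable_on n I (\<lambda>t. f t + g t)"
  using assms(2,3)
proof (induction n arbitrary: f g)
  case (Suc n)
  show ?case
  proof (rule times_differentiable_on_SucI[OF assms(1)])
    show "times_differentiable_on n I (\<lambda>t. deriv f t + deriv g t)"
      using Suc.prems by (intro Suc.IH) auto
    show "((\<lambda>t. f t + g t) has_real_derivative deriv f t + deriv g t) (at t)" if "t \<in> I" for t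
      by (intro DERIV_add times_differentiable_on_Suc_imp_DERIV[OF _ that]) (fact Suc.prems)+
  qed
qed simp

lemma times_differentiable_on_mult:
  assumes "open I" "times_differentiable_on n I f" "times_differentiable_on n I g"
  shows "times_differentiable_on n I (\<lambda>t. f t * g t)"
  using assms(2,3)
proof (induction n arbitrary: f g)
  case (Suc n)
  show ?case
  proof (rule times_differentiable_on_SucI[OF assms(1)])
    show "times_differentiable_on n I (\<lambda>t. deriv f t * g t + deriv g t * f t)"
      using Suc.prems times_differentiable_on_SucD[OF Suc.prems(1)]
        times_differentiable_on_SucD[OF Suc.prems(2)]
      by (intro times_differentiable_on_add[OF assms(1)] Suc.IH) auto
    show "((\<lambda>t. f t * g t) has_real_derivative deriv f t * g t + deriv g t * f t) (at t)" if "t \<in> I" for t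
      by (intro DERIV_mult times_differentiable_on_Suc_imp_DERIV[OF _ that]) (fact Suc.prems)+
  qed
qed simp

text \<open>
  The derivative \<open>- f' / f\<^sup>2\<close> is written as a product involving \<open>inverse f\<close> itself, so that the
  claim with one derivative fewer, for the same function, carries the induction.
\<close>
lemma times_differentiable_on_inverse:
  assumes "open I" "times_differentiable_on n I f" "\<And>t. t \<in> I \<Longrightarrow> f t \<noteq> 0"
  shows "times_differentiable_on n I (\<lambda>t. inverse (f t))"
  using assms(2)
proof (induction n)
  case (Suc n)
  show ?case
  proof (rule times_differentiable_on_SucI[OF assms(1)])
    have "times_differentiable_on n I (\<lambda>t. inverse (f t))"
      by (rule Suc.IH[OF times_differentiable_on_SucD[OF Suc.prems]])
    then show "times_differentiable_on n I (\<lambda>t. (-1) * (inverse (f t) * (deriv f t * inverse (f t))))"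
      using Suc.prems
      by (intro times_differentiable_on_mult[OF assms(1)] times_differentiable_on_const[OF assms(1)]) auto
    show "((\<lambda>t. inverse (f t)) has_real_derivative
        (-1) * (inverse (f t) * (deriv f t * inverse (f t)))) (at t)" if "t \<in> I" for t
      using DERIV_inverse'[OF times_differentiable_on_Suc_imp_DERIV[OF Suc.prems that] assms(3)[OF that]]
      by (simp add: mult.assoc)
  qed
qed simp

lemma times_differentiable_on_compose:
  assumes "open I" "times_differentiable_on n J f" "times_differentiable_on n I g" "g ` I \<subseteq> J"
  shows "times_differentiable_on n I (\<lambda>t. f (g t))"
  using assms(2,3)
proof (induction n arbitrary: f)
  case (Suc n)
  show ?case
  proof (rule times_differentiable_on_SucI[OF assms(1)])
    show "times_differentiable_on n I (\<lambda>t. deriv f (g t) * deriv g t)"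
      by (rule times_differentiable_on_mult[OF assms(1)
            Suc.IH[OF _ times_differentiable_on_SucD[OF Suc.prems(2)]]])
        (use Suc.prems in simp_all)
    show "((\<lambda>t. f (g t)) has_real_derivative deriv f (g t) * deriv g t) (at t)" if "t \<in> I" for t
      using that assms(4)
      by (intro DERIV_chain2[OF times_differentiable_on_Suc_imp_DERIV[OF Suc.prems(1)]
            times_differentiable_on_Suc_imp_DERIV[OF Suc.prems(2)]]) auto
  qed
qed simp

lemma smooth_on_const: "open I \<Longrightarrow> smooth_on I (\<lambda>_. a)"
  by (simp add: smooth_on_iff_times_differentiable_on times_differentiable_on_const)

lemma smooth_on_add: "open I \<Longrightarrow> smooth_on I f \<Longrightarrow> smooth_on I g \<Longrightarrow> smooth_on I (\<lambda>t. f t + g t)"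
  by (simp add: smooth_on_iff_times_differentiable_on times_differentiable_on_add)

lemma smooth_on_mult: "open I \<Longrightarrow> smooth_on I f \<Longrightarrow> smooth_on I g \<Longrightarrow> smooth_on I (\<lambda>t. f t * g t)"
  by (simp add: smooth_on_iff_times_differentiable_on times_differentiable_on_mult)

lemma smooth_on_diff:
  assumes "open I" "smooth_on I f" "smooth_on I g" shows "smooth_on I (\<lambda>t. f t - g t)"
  using smooth_on_add[OF assms(1,2) smooth_on_mult[OF assms(1) smooth_on_const[OF assms(1), of "-1"] assms(3)]]
  by simp

lemma smooth_on_power:
  assumes "open I" "smooth_on I f" shows "smooth_on I (\<lambda>t. f t ^ n)"
  by (induction n) (auto intro!: smooth_on_const smooth_on_mult assms)

lemma smooth_on_divide:
  assumes "open I" "smooth_on I f" "smooth_on I g" "\<And>t. t \<in> I \<Longrightarrow> g t \<noteq> 0"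
  shows "smooth_on I (\<lambda>t. f t / g t)"
  using assms unfolding divide_inverse
  by (simp add: smooth_on_iff_times_differentiable_on times_differentiable_on_mult
      times_differentiable_on_inverse)

lemma smooth_on_compose:
  "open I \<Longrightarrow> smooth_on J f \<Longrightarrow> smooth_on I g \<Longrightarrow> g ` I \<subseteq> J \<Longrightarrow> smooth_on I (\<lambda>t. f (g t))"
  unfolding smooth_on_iff_times_differentiable_on
  by (blast intro: times_differentiable_on_compose)

lemma smooth_on_deriv: "smooth_on I f \<Longrightarrow> smooth_on I (deriv f)"
  unfolding smooth_on_iff_times_differentiable_on
  using times_differentiable_on.simps(2) by blast

lemma smooth_on_imp_DERIV: "smooth_on I f \<Longrightarrow> t \<in> I \<Longrightarrow> (f has_real_derivative deriv f t) (at t)"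
  unfolding smooth_on_iff_times_differentiable_on
  using times_differentiable_on_Suc_imp_DERIV by blast

lemmas smooth_on_intros =
  smooth_on_const smooth_on_add smooth_on_mult smooth_on_diff smooth_on_power smooth_on_divide
  smooth_on_deriv

section \<open>Fields that depend on the radial coordinate only\<close>
lemma vector_2_eq_scaleR_axis: "vector [a, b] = a *\<^sub>R axis 1 1 + b *\<^sub>R (axis 2 1 :: real^2)"
  by (simp add: vec_eq_iff forall_2 axis_def)

lemma vector_2_eq_iff: "v = vector [a, b] \<longleftrightarrow> v $ 1 = a \<and> v $ 2 = b" for v :: "real^2"
  by (simp add: vec_eq_iff forall_2)

lemma dir_deriv_eq:
  "(F has_derivative F') (at p) \<Longrightarrow> dir_deriv F X p = F' (X p)"
  unfolding dir_deriv_def by (simp flip: frechet_derivative_at)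

lemma open_rot_domain: "open I \<Longrightarrow> open (rot_domain I)"
  using open_vimage_vec_nth[of I 1] by (simp add: rot_domain_def vimage_def) 

lemma has_derivative_radial:
  assumes "(u has_real_derivative u') (at (p $ 1))"
  shows "((\<lambda>q::real^2. u (q $ 1)) has_derivative (\<lambda>h. u' * h $ 1)) (at p)"
proof -
  have "((\<lambda>q::real^2. q $ 1) has_derivative (\<lambda>h. h $ 1)) (at p)"
    by (rule bounded_linear_imp_has_derivative[OF bounded_linear_vec_nth])
  from has_derivative_compose[OF this, of u] assms show ?thesis
    by (simp add: has_field_derivative_def)
qed

text \<open>
  Along a rotationally symmetric map all fields that occur depend on the radial coordinate alone. This
  lemma reduces their derivatives to ordinary ones; the field needs to be radial only on the
  coordinate domain, because that domain is open.
\<close>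
lemma dir_deriv_radial:
  assumes "open I" "p \<in> rot_domain I"
    and "\<And>q. q \<in> rot_domain I \<Longrightarrow> V q = vector [u (q $ 1), v (q $ 1)]"
    and u: "(u has_real_derivative u') (at (p $ 1))"
    and v: "(v has_real_derivative v') (at (p $ 1))"
  shows "dir_deriv V X p = (vector [u' * X p $ 1, v' * X p $ 1] :: real^2)"
proof -
  have "((\<lambda>q. vector [u (q $ 1), v (q $ 1)]) has_derivative
      (\<lambda>h. vector [u' * h $ 1, v' * h $ 1] :: real^2)) (at p)"
    unfolding vector_2_eq_scaleR_axis
    by (intro has_derivative_add bounded_linear.has_derivative[OF bounded_linear_scaleR_left]
        has_derivative_radial[OF u] has_derivative_radial[OF v])
  then have "(V has_derivative (\<lambda>h. vector [u' * h $ 1, v' * h $ 1] :: real^2)) (at p)"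
    by (rule has_derivative_transform_within_open[OF _ open_rot_domain[OF assms(1)] assms(2)])
      (simp add: assms(3))
  then show ?thesis by (rule dir_deriv_eq)
qed

section \<open>Connection and curvature of a rotationally symmetric metric\<close>
lemma matrix_inv_eqI:
  fixes A :: "'a::semiring_1^'n::finite^'n"
  assumes "A ** B = mat 1" "B ** A = mat 1"
  shows "matrix_inv A = B"
proof -
  have inv: "A ** matrix_inv A = mat 1 \<and> matrix_inv A ** A = mat 1"
    unfolding matrix_inv_def by (rule someI[of _ B]) (use assms in auto)
  have "matrix_inv A = matrix_inv A ** (A ** B)"
    by (simp add: assms)
  also have "\<dots> = B"
    by (simp only: matrix_mul_assoc inv matrix_mul_lid)
  finally show ?thesis .
qed

lemma matrix_inv_rot_metric:
  assumes "s (p $ 1) \<noteq> 0"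
  shows "matrix_inv (rot_metric s p) = vector [vector [1, 0], vector [0, 1 / (s (p $ 1))\<^sup>2]]"
  using assms unfolding rot_metric_def
  by (intro matrix_inv_eqI)
    (auto simp: vec_eq_iff forall_2 matrix_matrix_mult_def sum_2 mat_def)

text \<open>
  The only entry that is not constant is \<open>g\<^sub>2\<^sub>2 = s\<^sup>2\<close>, and it depends on the first coordinate only.
\<close>
lemma metric_partial_rot_metric:
  assumes "(s has_real_derivative s') (at (p $ 1))"
  shows "metric_partial (rot_metric s) l i j p =
    (if l = 1 \<and> i = 2 \<and> j = 2 then 2 * s (p $ 1) * s' else 0)"
proof -
  have 22: "frechet_derivative (\<lambda>q. rot_metric s q $ 2 $ 2) (at p) = (\<lambda>h. (2 * s (p $ 1) * s') * h $ 1)"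
  proof (rule frechet_derivative_at[symmetric])
    have "((\<lambda>t. (s t)\<^sup>2) has_real_derivative 2 * s (p $ 1) * s') (at (p $ 1))"
      using assms by (auto intro!: derivative_eq_intros)
    from has_derivative_radial[OF this]
    show "((\<lambda>q. rot_metric s q $ 2 $ 2) has_derivative (\<lambda>h. (2 * s (p $ 1) * s') * h $ 1)) (at p)"
      by (simp add: rot_metric_def)
  qed
  have const: "frechet_derivative (\<lambda>q. rot_metric s q $ i $ j) (at p) = (\<lambda>h. 0)" if "i \<noteq> 2 \<or> j \<noteq> 2"
    using that exhaust_2[of i] exhaust_2[of j] by (auto simp: rot_metric_def)
  show ?thesis
    unfolding metric_partial_def
    using const 22 exhaust_2[of l] by (cases "i = 2 \<and> j = 2") (auto simp: axis_def)
qed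

text \<open>
  Since \<open>\<partial>\<^sub>1 g\<^sub>2\<^sub>2 = 2 s s'\<close> is the only nonzero derivative of the metric, the only nonzero Christoffel
  symbols are \<open>\<Gamma>\<^sup>1\<^sub>2\<^sub>2 = - s s'\<close> and \<open>\<Gamma>\<^sup>2\<^sub>1\<^sub>2 = \<Gamma>\<^sup>2\<^sub>2\<^sub>1 = s' / s\<close>.
\<close>
lemma chris_form_rot_metric:
  assumes "(s has_real_derivative s') (at (p $ 1))" "s (p $ 1) \<noteq> 0"
  shows "chris_form (rot_metric s) p u v =
    vector [- (s (p $ 1) * s' * u $ 2 * v $ 2), s' / s (p $ 1) * (u $ 1 * v $ 2 + u $ 2 * v $ 1)]"
  unfolding chris_form_def christoffel_def matrix_inv_rot_metric[of s p, OF assms(2)]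
    metric_partial_rot_metric[OF assms(1)] vector_2_eq_iff
  using assms(2) by (simp add: sum_2 field_simps power2_eq_square)

lemma dir_deriv_const: "dir_deriv (\<lambda>_. w) X p = 0"
  by (simp add: dir_deriv_eq[OF has_derivative_const])

lemma nabla_const: "nabla g (\<lambda>_. u) (\<lambda>_. w) = (\<lambda>p. chris_form g p u w)"
  by (simp add: nabla_def dir_deriv_const)

lemma nabla_frame: "nabla g (frame i) (frame j) p = chris_form g p (axis i 1) (axis j 1)"
  by (simp add: frame_def nabla_const)

lemma metric_trace_rot_metric:
  assumes "s (p $ 1) \<noteq> 0"
  shows "metric_trace (rot_metric s) B p =
    B (frame 1) (frame 1) p + (1 / (s (p $ 1))\<^sup>2) *\<^sub>R B (frame 2) (frame 2) p"
  unfolding metric_trace_def matrix_inv_rot_metric[of s p, OF assms] by (simp add: sum_2)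

text \<open>
  On a surface \<open>R(u, v) w = K (\<langle>v, w\<rangle> u - \<langle>u, w\<rangle> v)\<close>, here with Gauss curvature
  \<open>K = - \<lambda>'' / \<lambda>\<close>. In coordinates both components carry the factor \<open>u\<^sup>1 v\<^sup>2 - u\<^sup>2 v\<^sup>1\<close>. The formula
  follows by differentiating the Christoffel terms of the constant extensions; the contributions in
  \<open>\<lambda>'\<^sup>2\<close> cancel.
\<close>
lemma curvature_at_rot_metric:
  assumes "open J" "smooth_on J lam" "\<And>s. s \<in> J \<Longrightarrow> lam s > 0" "q \<in> rot_domain J"
  shows "curvature_at (rot_metric lam) q u v w =
    (let K = - deriv (deriv lam) (q $ 1) / lam (q $ 1); A = u $ 1 * v $ 2 - u $ 2 * v $ 1
     in vector [K * (lam (q $ 1))\<^sup>2 * w $ 2 * A, - K * w $ 1 * A])"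
proof -
  have J: "t \<in> J \<Longrightarrow> (lam has_real_derivative deriv lam t) (at t)"
    "t \<in> J \<Longrightarrow> (deriv lam has_real_derivative deriv (deriv lam) t) (at t)" for t
    using assms(2) by (auto intro: smooth_on_imp_DERIV smooth_on_deriv)
  have nz: "lam t \<noteq> 0" if "t \<in> J" for t
    using assms(3)[OF that] by simp
  have q: "q $ 1 \<in> J"
    using assms(4) by (simp add: rot_domain_def)
  have chris: "chris_form (rot_metric lam) p u v =
      vector [- (lam (p $ 1) * deriv lam (p $ 1) * u $ 2 * v $ 2),
        deriv lam (p $ 1) / lam (p $ 1) * (u $ 1 * v $ 2 + u $ 2 * v $ 1)]"
    if "p \<in> rot_domain J" for p u v
    using chris_form_rot_metric J(1) nz that unfolding rot_domain_def by blast
  have second: "nabla (rot_metric lam) (\<lambda>_. u) (nabla (rot_metric lam) (\<lambda>_. v) (\<lambda>_. w)) q =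
      vector [- (((deriv lam (q $ 1))\<^sup>2 + lam (q $ 1) * deriv (deriv lam) (q $ 1)) * v $ 2 * w $ 2 * u $ 1),
        (deriv (deriv lam) (q $ 1) / lam (q $ 1) - (deriv lam (q $ 1) / lam (q $ 1))\<^sup>2)
          * (v $ 1 * w $ 2 + v $ 2 * w $ 1) * u $ 1]
      + chris_form (rot_metric lam) q u (chris_form (rot_metric lam) q v w)" for u v w :: "real^2"
  proof -
    have "dir_deriv (\<lambda>p. chris_form (rot_metric lam) p v w) (\<lambda>_. u) q =
      vector [- (((deriv lam (q $ 1))\<^sup>2 + lam (q $ 1) * deriv (deriv lam) (q $ 1)) * v $ 2 * w $ 2) * u $ 1,
        (deriv (deriv lam) (q $ 1) / lam (q $ 1) - (deriv lam (q $ 1) / lam (q $ 1))\<^sup>2)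
          * (v $ 1 * w $ 2 + v $ 2 * w $ 1) * u $ 1]"
    proof (rule dir_deriv_radial[OF assms(1,4)])
      show "chris_form (rot_metric lam) p v w =
          vector [- (lam (p $ 1) * deriv lam (p $ 1) * v $ 2 * w $ 2),
            deriv lam (p $ 1) / lam (p $ 1) * (v $ 1 * w $ 2 + v $ 2 * w $ 1)]"
        if "p \<in> rot_domain J" for p
        by (rule chris[OF that])
      show "((\<lambda>t. - (lam t * deriv lam t * v $ 2 * w $ 2)) has_real_derivative
          - (((deriv lam (q $ 1))\<^sup>2 + lam (q $ 1) * deriv (deriv lam) (q $ 1)) * v $ 2 * w $ 2)) (at (q $ 1))"
        by (auto intro!: derivative_eq_intros J q simp: algebra_simps power2_eq_square)
      show "((\<lambda>t. deriv lam t / lam t * (v $ 1 * w $ 2 + v $ 2 * w $ 1)) has_real_derivative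
          (deriv (deriv lam) (q $ 1) / lam (q $ 1) - (deriv lam (q $ 1) / lam (q $ 1))\<^sup>2)
          * (v $ 1 * w $ 2 + v $ 2 * w $ 1)) (at (q $ 1))"
        by (rule derivative_eq_intros J q nz refl)+ (simp add: nz[OF q] field_simps power2_eq_square)
    qed
    then show ?thesis
      unfolding nabla_const by (simp add: nabla_def)
  qed
  have zero: "nabla (rot_metric lam) (lie_bracket (\<lambda>_. u) (\<lambda>_. v)) (\<lambda>_. w) q = 0"
    by (simp add: nabla_def lie_bracket_def dir_deriv_const chris_form_def zero_vec_def)
  show ?thesis
    unfolding curvature_at_def curvature_def second zero chris[OF assms(4)] Let_def vector_2_eq_iff
    using nz[OF q] by (simp add: field_simps power2_eq_square)
qed

section \<open>The tension field of the map\<close>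
locale rot_sym_map =
  fixes c k a2 :: real and I J :: "real set" and \<sigma> lam \<rho> :: "real \<Rightarrow> real" and \<phi> :: "real^2 \<Rightarrow> real^2"
  assumes open_I: "open I" and open_J: "open J"
    and \<sigma>_smooth: "smooth_on I \<sigma>" and \<sigma>_pos: "\<And>r. r \<in> I \<Longrightarrow> \<sigma> r > 0"
    and lam_smooth: "smooth_on J lam" and lam_pos: "\<And>s. s \<in> J \<Longrightarrow> lam s > 0"
    and \<rho>_smooth: "smooth_on I \<rho>" and \<rho>_in: "\<And>r. r \<in> I \<Longrightarrow> \<rho> r \<in> J"
    and map_eq: "\<phi> = (\<lambda>p. vector [\<rho> (p $ 1), c * p $ 1 + k * p $ 2 + a2])"
begin

text \<open>
  The tension field turns out to be radial, so its components are functions of one variable and the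
  bitension field involves only their ordinary derivatives.
\<close>
definition radial_tension :: "real \<Rightarrow> real" where
  "radial_tension r = deriv (deriv \<rho>) r + deriv \<sigma> r / \<sigma> r * deriv \<rho> r
     - (c\<^sup>2 + k\<^sup>2 / (\<sigma> r)\<^sup>2) * (lam (\<rho> r) * deriv lam (\<rho> r))"

definition angular_tension :: "real \<Rightarrow> real" where
  "angular_tension r = 2 * c * deriv \<rho> r * deriv lam (\<rho> r) / lam (\<rho> r) + c * deriv \<sigma> r / \<sigma> r"

text \<open>
  The bitension field differentiates the tension field twice, so two derivatives of its components are
  needed. They exist because the components are built from smooth functions.
\<close>
lemma radial_tension_smooth: "smooth_on I radial_tension"
  and angular_tension_smooth: "smooth_on I angular_tension"
proof -
  have "\<rho> ` I \<subseteq> J"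
    using \<rho>_in by blast
  then have "smooth_on I (\<lambda>r. lam (\<rho> r))" "smooth_on I (\<lambda>r. deriv lam (\<rho> r))"
    using smooth_on_compose[OF open_I _ \<rho>_smooth] lam_smooth smooth_on_deriv by blast+
  moreover have "\<sigma> r \<noteq> 0" "lam (\<rho> r) \<noteq> 0" if "r \<in> I" for r
    using \<sigma>_pos[OF that] lam_pos[OF \<rho>_in[OF that]] by simp_all
  ultimately show "smooth_on I radial_tension" "smooth_on I angular_tension"
    unfolding radial_tension_def[abs_def] angular_tension_def[abs_def]
    by (auto intro!: smooth_on_intros open_I \<sigma>_smooth \<rho>_smooth)
qed

lemma dir_deriv_map:
  assumes "p \<in> rot_domain I"
  shows "dir_deriv \<phi> X p = vector [deriv \<rho> (p $ 1) * X p $ 1, c * X p $ 1 + k * X p $ 2]"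
proof -
  have proj: "((\<lambda>q::real^2. q $ i) has_derivative (\<lambda>h. h $ i)) (at p)" for i
    by (rule bounded_linear_imp_has_derivative[OF bounded_linear_vec_nth])
  have \<rho>: "((\<lambda>q. \<rho> (q $ 1)) has_derivative (\<lambda>h. deriv \<rho> (p $ 1) * h $ 1)) (at p)"
    using assms \<rho>_smooth by (intro has_derivative_radial smooth_on_imp_DERIV) (auto simp: rot_domain_def)
  have angle: "((\<lambda>q. c * q $ 1 + k * q $ 2 + a2) has_derivative (\<lambda>h. c * h $ 1 + k * h $ 2)) (at p)"
    by (rule derivative_eq_intros proj refl)+ simp
  have "((\<lambda>q. vector [\<rho> (q $ 1), c * q $ 1 + k * q $ 2 + a2]) has_derivative
      (\<lambda>h. vector [deriv \<rho> (p $ 1) * h $ 1, c * h $ 1 + k * h $ 2] :: real^2)) (at p)"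
    unfolding vector_2_eq_scaleR_axis
    by (intro has_derivative_add bounded_linear.has_derivative[OF bounded_linear_scaleR_left] \<rho> angle)
  then show ?thesis
    unfolding map_eq by (rule dir_deriv_eq)
qed

text \<open>
  The covariant derivative of a radial field along the map in direction \<open>X\<close>. If \<open>X\<close> is a coordinate
  field then the result is radial again, so the formula can be iterated: it is applied to the
  differential of the map, to the tension field, and to the first covariant derivatives of the tension
  field.
\<close>
lemma pull_nabla_radial:
  assumes "p \<in> rot_domain I"
    and V: "\<forall>q\<in>rot_domain I. V q = vector [u (q $ 1), v (q $ 1)]"
    and "(u has_real_derivative u') (at (p $ 1))" "(v has_real_derivative v') (at (p $ 1))"
  defines "r \<equiv> p $ 1"
  shows "pull_nabla (rot_metric lam) \<phi> X V p =
    vector [X p $ 1 * u' - lam (\<rho> r) * deriv lam (\<rho> r) * (c * X p $ 1 + k * X p $ 2) * v r,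
      X p $ 1 * v' + deriv lam (\<rho> r) / lam (\<rho> r)
        * (deriv \<rho> r * X p $ 1 * v r + (c * X p $ 1 + k * X p $ 2) * u r)]"
proof -
  have r: "\<rho> r \<in> J"
    using assms(1) \<rho>_in by (simp add: rot_domain_def r_def)
  have \<phi>1: "\<phi> p $ 1 = \<rho> r"
    by (simp add: map_eq r_def)
  have "chris_form (rot_metric lam) (\<phi> p) a b = vector [- (lam (\<rho> r) * deriv lam (\<rho> r) * a $ 2 * b $ 2),
      deriv lam (\<rho> r) / lam (\<rho> r) * (a $ 1 * b $ 2 + a $ 2 * b $ 1)]" for a b
    using chris_form_rot_metric[of lam "deriv lam (\<rho> r)" "\<phi> p" a b]
      smooth_on_imp_DERIV[OF lam_smooth r] lam_pos[OF r] by (simp add: \<phi>1)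
  then show ?thesis
    using dir_deriv_radial[OF open_I assms(1) bspec[OF V] assms(3,4), of X]
    by (simp add: pull_nabla_def dir_deriv_map[OF assms(1)] bspec[OF V assms(1)]
        vector_2_eq_iff r_def)
qed

lemma in_domain: "p \<in> rot_domain I \<Longrightarrow> p $ 1 \<in> I"
  by (simp add: rot_domain_def)

lemmas source_DERIV =
  smooth_on_imp_DERIV[OF \<sigma>_smooth] smooth_on_imp_DERIV[OF \<rho>_smooth]
  smooth_on_imp_DERIV[OF smooth_on_deriv[OF \<rho>_smooth]]
  smooth_on_imp_DERIV[OF radial_tension_smooth]
  smooth_on_imp_DERIV[OF angular_tension_smooth]
  smooth_on_imp_DERIV[OF smooth_on_deriv[OF radial_tension_smooth]]
  smooth_on_imp_DERIV[OF smooth_on_deriv[OF angular_tension_smooth]]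

lemma target_DERIV:
  assumes "r \<in> I"
  shows "((\<lambda>r. lam (\<rho> r)) has_real_derivative deriv lam (\<rho> r) * deriv \<rho> r) (at r)"
    and "((\<lambda>r. deriv lam (\<rho> r)) has_real_derivative deriv (deriv lam) (\<rho> r) * deriv \<rho> r) (at r)"
  using assms \<rho>_in lam_smooth \<rho>_smooth
  by (auto intro: DERIV_chain2[OF smooth_on_imp_DERIV[of J] smooth_on_imp_DERIV[of I]] smooth_on_deriv)

text \<open>
  The metric of the source is diagonal, so its traces involve only these two covariant derivatives.
\<close>
lemma nabla_frame_source:
  assumes "p \<in> rot_domain I"
  shows "nabla (rot_metric \<sigma>) (frame 1) (frame 1) p = 0"
    and "nabla (rot_metric \<sigma>) (frame 2) (frame 2) p = vector [- (\<sigma> (p $ 1) * deriv \<sigma> (p $ 1)), 0]"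
  using \<sigma>_pos[OF in_domain[OF assms]]
  by (simp_all add: nabla_frame vec_eq_iff forall_2 axis_def
      chris_form_rot_metric[of \<sigma>, OF source_DERIV(1)[OF in_domain[OF assms]]])

text \<open>
  The trace is \<open>\<nabla>\<^sub>r d\<phi>(\<partial>\<^sub>r) + \<sigma>\<^sup>-\<^sup>2 (\<nabla>\<^sub>\<theta> d\<phi>(\<partial>\<^sub>\<theta>) + \<sigma> \<sigma>' d\<phi>(\<partial>\<^sub>r))\<close>, where
  \<open>d\<phi>(\<partial>\<^sub>r) = (\<rho>', c)\<close> and \<open>d\<phi>(\<partial>\<^sub>\<theta>) = (0, k)\<close>.
\<close>
lemma tension_eq:
  assumes "p \<in> rot_domain I"
  shows "tension (rot_metric \<sigma>) (rot_metric lam) \<phi> p =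
    vector [radial_tension (p $ 1), angular_tension (p $ 1)]"
proof -
  note r = in_domain[OF assms]
  note D = source_DERIV[OF r]
  have nz: "\<sigma> (p $ 1) \<noteq> 0" "lam (\<rho> (p $ 1)) \<noteq> 0"
    using \<sigma>_pos[OF r] lam_pos[OF \<rho>_in[OF r]] by auto
  have V1: "\<forall>q\<in>rot_domain I. dir_deriv \<phi> (frame 1) q = vector [deriv \<rho> (q $ 1), c]"
    by (simp add: dir_deriv_map frame_def axis_def)
  have V2: "\<forall>q\<in>rot_domain I. dir_deriv \<phi> (frame 2) q = vector [0, k]"
    by (simp add: dir_deriv_map frame_def axis_def)
  have P1: "pull_nabla (rot_metric lam) \<phi> (frame 1) (dir_deriv \<phi> (frame 1)) p =
      vector [deriv (deriv \<rho>) (p $ 1) - lam (\<rho> (p $ 1)) * deriv lam (\<rho> (p $ 1)) * c * c,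
        deriv lam (\<rho> (p $ 1)) / lam (\<rho> (p $ 1)) * (deriv \<rho> (p $ 1) * c + c * deriv \<rho> (p $ 1))]"
    unfolding pull_nabla_radial[where u = "deriv \<rho>" and v = "\<lambda>_. c", OF assms V1 D(3) DERIV_const]
    by (simp add: frame_def axis_def)
  have P2: "pull_nabla (rot_metric lam) \<phi> (frame 2) (dir_deriv \<phi> (frame 2)) p =
      vector [- (lam (\<rho> (p $ 1)) * deriv lam (\<rho> (p $ 1)) * k * k), 0]"
    unfolding pull_nabla_radial[where u = "\<lambda>_. 0" and v = "\<lambda>_. k", OF assms V2 DERIV_const DERIV_const]
    by (simp add: frame_def axis_def)
  show ?thesis
    unfolding tension_def metric_trace_rot_metric[of \<sigma> p, OF nz(1)] second_fundamental_form_def P1 P2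
      dir_deriv_map[OF assms] nabla_frame_source[OF assms] vector_2_eq_iff
    using nz by (simp add: frame_def axis_def radial_tension_def angular_tension_def
        field_simps power2_eq_square)
qed

section \<open>The bitension field of the map\<close>
text \<open>
  The second equation of the biharmonic system is \<open>c\<close> times this expression, because the second
  component of the tension field equals \<open>c (2 \<rho>' \<lambda>'(\<rho>) / \<lambda>(\<rho>) + \<sigma>' / \<sigma>)\<close>.
  Here and in the radial component, \<open>(\<lambda>\<lambda>')'\<close> is written as \<open>\<lambda>'\<^sup>2 + \<lambda> \<lambda>''\<close>.
\<close>
definition angular_bitension :: "real \<Rightarrow> real" where
  "angular_bitension r = deriv (deriv angular_tension) r
     + (2 * deriv \<rho> r * deriv lam (\<rho> r) / lam (\<rho> r) + deriv \<sigma> r / \<sigma> r) * deriv angular_tension r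
     + 2 * c * deriv lam (\<rho> r) / lam (\<rho> r) * deriv radial_tension r
     + 2 * c * (deriv \<sigma> r * deriv lam (\<rho> r) / (\<sigma> r * lam (\<rho> r))
         + deriv \<rho> r * ((deriv lam (\<rho> r))\<^sup>2 + lam (\<rho> r) * deriv (deriv lam) (\<rho> r)) / (lam (\<rho> r))\<^sup>2)
       * radial_tension r"

definition radial_bitension :: "real \<Rightarrow> real" where
  "radial_bitension r = deriv (deriv radial_tension) r + deriv \<sigma> r / \<sigma> r * deriv radial_tension r
     - (c\<^sup>2 + k\<^sup>2 / (\<sigma> r)\<^sup>2) * ((deriv lam (\<rho> r))\<^sup>2 + lam (\<rho> r) * deriv (deriv lam) (\<rho> r)) * radial_tension r
     - (2 * c * deriv angular_tension r + (angular_tension r)\<^sup>2) * (lam (\<rho> r) * deriv lam (\<rho> r))"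

text \<open>
  With \<open>\<tau> = (x, y)\<close>, \<open>L = (\<lambda>\<lambda>')(\<rho>)\<close> and \<open>m = \<lambda>'(\<rho>) / \<lambda>(\<rho>)\<close>, the first covariant derivatives
  \<open>\<nabla>\<^sub>r \<tau> = (A, B)\<close> and \<open>\<nabla>\<^sub>\<theta> \<tau> = (C, E)\<close> are radial, and differentiating them once more gives the
  rough Laplacian of \<open>\<tau>\<close>.

  In the radial component the curvature term combines with \<open>\<lambda>'\<^sup>2\<close> from the Christoffel symbols into
  \<open>(\<lambda>\<lambda>')'\<close>, and the terms linear in \<open>y\<close> without derivative are
  \<open>- L y (2 c \<rho>' m + c \<sigma>' / \<sigma>) = - L y\<^sup>2\<close>. In the angular component the terms in \<open>y\<close> without
  derivative are \<open>m y (\<rho>'' + \<sigma>' \<rho>' / \<sigma> - (c\<^sup>2 + k\<^sup>2 / \<sigma>\<^sup>2) L) = m x y\<close>, since the curvature term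
  cancels \<open>(m' + m\<^sup>2) \<rho>'\<^sup>2 y\<close> with \<open>m' = dm/d\<rho>\<close>; inserting \<open>y\<close> turns \<open>m x y\<close> into a multiple of \<open>x\<close>.
\<close>
lemma bitension_eq:
  assumes "p \<in> rot_domain I"
  shows "bitension (rot_metric \<sigma>) (rot_metric lam) \<phi> p =
    vector [radial_bitension (p $ 1), angular_bitension (p $ 1)]"
proof -
  define r where "r = p $ 1"
  let ?x = radial_tension and ?y = angular_tension
  let ?L = "\<lambda>r. lam (\<rho> r) * deriv lam (\<rho> r)" and ?m = "\<lambda>r. deriv lam (\<rho> r) / lam (\<rho> r)"
  let ?\<tau> = "tension (rot_metric \<sigma>) (rot_metric lam) \<phi>"
  have r: "r \<in> I"
    using in_domain[OF assms] by (simp add: r_def)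
  note D = source_DERIV
  have nz: "\<sigma> r \<noteq> 0" "lam (\<rho> r) \<noteq> 0"
    using \<sigma>_pos[OF r] lam_pos[OF \<rho>_in[OF r]] by auto
  have \<phi>p: "\<phi> p \<in> rot_domain J" "\<phi> p $ 1 = \<rho> r"
    using \<rho>_in[OF r] by (simp_all add: map_eq rot_domain_def r_def)
  have P: "pull_nabla (rot_metric lam) \<phi> X ?\<tau> q =
    vector [X q $ 1 * deriv ?x (q $ 1) - ?L (q $ 1) * (c * X q $ 1 + k * X q $ 2) * ?y (q $ 1),
      X q $ 1 * deriv ?y (q $ 1) + ?m (q $ 1)
        * (deriv \<rho> (q $ 1) * X q $ 1 * ?y (q $ 1) + (c * X q $ 1 + k * X q $ 2) * ?x (q $ 1))]"
    if "q \<in> rot_domain I" for q X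
    using pull_nabla_radial[where V = ?\<tau> and u = ?x and v = ?y, OF that _ D(4,5)[OF in_domain[OF that]]]
    by (simp add: tension_eq)
  define A where "A r = deriv ?x r - c * ?L r * ?y r" for r
  define B where "B r = deriv ?y r + ?m r * (deriv \<rho> r * ?y r + c * ?x r)" for r
  define C where "C r = - (k * ?L r * ?y r)" for r
  define E where "E r = k * ?m r * ?x r" for r
  define L' where "L' = ((deriv lam (\<rho> r))\<^sup>2 + lam (\<rho> r) * deriv (deriv lam) (\<rho> r)) * deriv \<rho> r"
  define m' where "m' = (deriv (deriv lam) (\<rho> r) / lam (\<rho> r) - (?m r)\<^sup>2) * deriv \<rho> r"
  have L': "(?L has_real_derivative L') (at r)"
    unfolding L'_def
    by (rule derivative_eq_intros target_DERIV[OF r] refl)+ (simp add: algebra_simps power2_eq_square)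
  have m': "(?m has_real_derivative m') (at r)"
    unfolding m'_def
    by (rule derivative_eq_intros target_DERIV[OF r] nz refl)+
      (simp add: nz field_simps power2_eq_square)
  define A' where "A' = deriv (deriv ?x) r - c * (L' * ?y r + ?L r * deriv ?y r)"
  define B' where "B' = deriv (deriv ?y) r + m' * (deriv \<rho> r * ?y r + c * ?x r)
    + ?m r * (deriv (deriv \<rho>) r * ?y r + deriv \<rho> r * deriv ?y r + c * deriv ?x r)"
  have A': "(A has_real_derivative A') (at r)"
    unfolding A_def A'_def
    by (rule derivative_eq_intros D[OF r] L' refl)+ (simp add: algebra_simps)
  have B': "(B has_real_derivative B') (at r)"
    unfolding B_def B'_def
    by (rule derivative_eq_intros D[OF r] m' refl)+ (simp add: algebra_simps)
  define C' where "C' = - (k * (L' * ?y r + ?L r * deriv ?y r))"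
  define E' where "E' = k * (m' * ?x r + ?m r * deriv ?x r)"
  have C': "(C has_real_derivative C') (at r)"
    unfolding C_def C'_def
    by (rule derivative_eq_intros D[OF r] L' refl)+ (simp add: algebra_simps)
  have E': "(E has_real_derivative E') (at r)"
    unfolding E_def E'_def
    by (rule derivative_eq_intros D[OF r] m' refl)+ (simp add: algebra_simps)
  have V1: "\<forall>q\<in>rot_domain I. pull_nabla (rot_metric lam) \<phi> (frame 1) ?\<tau> q = vector [A (q $ 1), B (q $ 1)]"
    by (simp add: P A_def B_def frame_def axis_def ac_simps)
  have V2: "\<forall>q\<in>rot_domain I. pull_nabla (rot_metric lam) \<phi> (frame 2) ?\<tau> q = vector [C (q $ 1), E (q $ 1)]"
    by (simp add: P C_def E_def frame_def axis_def ac_simps)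
  note P1 = pull_nabla_radial[where u = A and v = B, OF assms V1 A'[unfolded r_def] B'[unfolded r_def]]
  note P2 = pull_nabla_radial[where u = C and v = E, OF assms V2 C'[unfolded r_def] E'[unfolded r_def]]
  have R: "curvature_at (rot_metric lam) (\<phi> p) u v w =
      (let K = - deriv (deriv lam) (\<rho> r) / lam (\<rho> r); A = u $ 1 * v $ 2 - u $ 2 * v $ 1
       in vector [K * (lam (\<rho> r))\<^sup>2 * w $ 2 * A, - K * w $ 1 * A])" for u v w
    using curvature_at_rot_metric[OF open_J lam_smooth lam_pos \<phi>p(1)] by (simp add: \<phi>p(2))
  note bi = bitension_def metric_trace_rot_metric[of \<sigma> p, OF nz(1)[unfolded r_def]] P1 P2 P[OF assms]
      R Let_def dir_deriv_map[OF assms] nabla_frame_source[OF assms] tension_eq[OF assms]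
  have 1: "bitension (rot_metric \<sigma>) (rot_metric lam) \<phi> p $ 1 =
      A' - c * ?L r * B r - k * ?L r * E r / (\<sigma> r)\<^sup>2 + deriv \<sigma> r / \<sigma> r * A r
      + deriv (deriv lam) (\<rho> r) * lam (\<rho> r) * (c * (deriv \<rho> r * ?y r - c * ?x r) - k\<^sup>2 * ?x r / (\<sigma> r)\<^sup>2)"
    unfolding bi
    using nz by (simp add: frame_def axis_def A_def field_simps power2_eq_square flip: r_def)
  have 2: "bitension (rot_metric \<sigma>) (rot_metric lam) \<phi> p $ 2 =
      B' + ?m r * (deriv \<rho> r * B r + c * A r) + k * ?m r * C r / (\<sigma> r)\<^sup>2 + deriv \<sigma> r / \<sigma> r * B r
      - deriv (deriv lam) (\<rho> r) / lam (\<rho> r) * deriv \<rho> r * (deriv \<rho> r * ?y r - c * ?x r)"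
    unfolding bi
    using nz by (simp add: frame_def axis_def B_def field_simps power2_eq_square flip: r_def)
  \<comment> \<open>The two defining equations are what brings the sum into the form of the system:
    \<open>y\<close> is expanded, and \<open>\<rho>''\<close> is eliminated in favour of \<open>x\<close>.\<close>
  have y: "?y r = 2 * c * deriv \<rho> r * deriv lam (\<rho> r) / lam (\<rho> r) + c * deriv \<sigma> r / \<sigma> r"
    by (simp add: angular_tension_def)
  have x: "deriv (deriv \<rho>) r = ?x r - deriv \<sigma> r / \<sigma> r * deriv \<rho> r + (c\<^sup>2 + k\<^sup>2 / (\<sigma> r)\<^sup>2) * ?L r"
    by (simp add: radial_tension_def)
  have "radial_bitension r = A' - c * ?L r * B r - k * ?L r * E r / (\<sigma> r)\<^sup>2 + deriv \<sigma> r / \<sigma> r * A r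
      + deriv (deriv lam) (\<rho> r) * lam (\<rho> r) * (c * (deriv \<rho> r * ?y r - c * ?x r) - k\<^sup>2 * ?x r / (\<sigma> r)\<^sup>2)"
    unfolding radial_bitension_def A'_def A_def B_def E_def L'_def y
    using nz by (simp add: field_simps power2_eq_square)
  moreover have "angular_bitension r =
      B' + ?m r * (deriv \<rho> r * B r + c * A r) + k * ?m r * C r / (\<sigma> r)\<^sup>2 + deriv \<sigma> r / \<sigma> r * B r
      - deriv (deriv lam) (\<rho> r) / lam (\<rho> r) * deriv \<rho> r * (deriv \<rho> r * ?y r - c * ?x r)"
    unfolding angular_bitension_def B'_def A_def B_def C_def m'_def x y
    using nz by (simp add: field_simps power2_eq_square)
  ultimately show ?thesis
    using 1 2 by (simp add: vector_2_eq_iff r_def)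
qed

text \<open>
  Multiplying the angular component by \<open>c\<close> loses nothing: for \<open>c = 0\<close> the angular tension vanishes
  identically, and with it every term of the angular component of the bitension field.
\<close>
lemma angular_bitension_eq_0_iff:
  "angular_bitension r = 0 \<longleftrightarrow> c * angular_bitension r = 0"
proof (cases "c = 0")
  case True
  then have "angular_tension = (\<lambda>_. 0)"
    unfolding angular_tension_def[abs_def] by (simp add: fun_eq_iff)
  moreover have "deriv (\<lambda>_::real. 0::real) = (\<lambda>_. 0)"
    by (simp add: fun_eq_iff)
  ultimately have "angular_bitension r = 0"
    unfolding angular_bitension_def using True by simp
  then show ?thesis by simp
qed simp

text \<open>
  Every \<open>r\<close> in the interval is the radial coordinate of some point, so the equations on the coordinate
  domain are ordinary differential equations on the interval.
\<close>
lemma biharmonic_iff: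
  "biharmonic_on (rot_domain I) (rot_metric \<sigma>) (rot_metric lam) \<phi> \<longleftrightarrow>
    (\<forall>r\<in>I. radial_bitension r = 0 \<and> c * angular_bitension r = 0)"
proof -
  have "(vector [a, b] :: real^2) = 0 \<longleftrightarrow> a = 0 \<and> b = 0" for a b
    by (simp add: vec_eq_iff forall_2)
  then have "biharmonic_on (rot_domain I) (rot_metric \<sigma>) (rot_metric lam) \<phi> \<longleftrightarrow>
    (\<forall>p\<in>rot_domain I. radial_bitension (p $ 1) = 0 \<and> c * angular_bitension (p $ 1) = 0)"
    using angular_bitension_eq_0_iff by (simp add: biharmonic_on_def bitension_eq)
  also have "\<dots> \<longleftrightarrow> (\<forall>r\<in>I. radial_bitension r = 0 \<and> c * angular_bitension r = 0)"
  proof -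
    have "vector [r, 0] \<in> rot_domain I" if "r \<in> I" for r
      using that by (simp add: rot_domain_def)
    then show ?thesis
      by (metis in_domain vector_2(1))
  qed
  finally show ?thesis .
qed

end

section \<open>The biharmonic equation as an ordinary differential system\<close>
theorem lemma2p2:
  fixes c k a2 :: real
    and I J :: "real set"
    and \<sigma> lam \<rho> ll x y :: "real \<Rightarrow> real"
    and \<phi> :: "real^2 \<Rightarrow> real^2"
  assumes I: "open I" "is_interval I"
    and J: "open J" "is_interval J"
    and \<sigma>: "smooth_on I \<sigma>" "\<And>r. r \<in> I \<Longrightarrow> \<sigma> r > 0"
    and lam: "smooth_on J lam" "\<And>s. s \<in> J \<Longrightarrow> lam s > 0"
    and \<rho>: "smooth_on I \<rho>" "\<And>r. r \<in> I \<Longrightarrow> \<rho> r \<in> J"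
    and \<phi>: "\<phi> = (\<lambda>p. vector [\<rho> (p $ 1), c * p $ 1 + k * p $ 2 + a2])"
    and ll: "ll = (\<lambda>s. lam s * deriv lam s)"
    and x: "x = (\<lambda>r. deriv (deriv \<rho>) r + deriv \<sigma> r / \<sigma> r * deriv \<rho> r
                    - (c\<^sup>2 + k\<^sup>2 / (\<sigma> r)\<^sup>2) * ll (\<rho> r))"
    and y: "y = (\<lambda>r. 2 * c * deriv \<rho> r * deriv lam (\<rho> r) / lam (\<rho> r) + c * deriv \<sigma> r / \<sigma> r)"
  shows "(\<forall>p \<in> rot_domain I.
            tension (rot_metric \<sigma>) (rot_metric lam) \<phi> p = vector [x (p $ 1), y (p $ 1)]) \<and>
         (biharmonic_on (rot_domain I) (rot_metric \<sigma>) (rot_metric lam) \<phi> \<longleftrightarrow>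
           (\<forall>r\<in>I.
              deriv (deriv x) r + deriv \<sigma> r / \<sigma> r * deriv x r
                - (c\<^sup>2 + k\<^sup>2 / (\<sigma> r)\<^sup>2) * deriv ll (\<rho> r) * x r
                - (2 * c * deriv y r + (y r)\<^sup>2) * ll (\<rho> r) = 0 \<and>
              c * deriv (deriv y) r + y r * deriv y r
                + 2 * c\<^sup>2 * deriv lam (\<rho> r) / lam (\<rho> r) * deriv x r
                + 2 * c\<^sup>2 * (deriv \<sigma> r * deriv lam (\<rho> r) / (\<sigma> r * lam (\<rho> r))
                            + deriv \<rho> r * deriv ll (\<rho> r) / (lam (\<rho> r))\<^sup>2) * x r = 0))"
proof -
  interpret rot_sym_map c k a2 I J \<sigma> lam \<rho> \<phi>
    by unfold_locales (fact I J \<sigma> lam \<rho> \<phi>)+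
  have x_eq: "x = radial_tension" and y_eq: "y = angular_tension"
    by (simp_all add: fun_eq_iff x y ll radial_tension_def angular_tension_def)
  have ll': "deriv ll (\<rho> r) = (deriv lam (\<rho> r))\<^sup>2 + lam (\<rho> r) * deriv (deriv lam) (\<rho> r)"
    if "r \<in> I" for r
  proof (rule DERIV_imp_deriv)
    show "(ll has_real_derivative (deriv lam (\<rho> r))\<^sup>2 + lam (\<rho> r) * deriv (deriv lam) (\<rho> r)) (at (\<rho> r))"
      unfolding ll
      using DERIV_mult[OF smooth_on_imp_DERIV[OF lam(1) \<rho>(2)[OF that]]
          smooth_on_imp_DERIV[OF smooth_on_deriv[OF lam(1)] \<rho>(2)[OF that]]]
      by (simp add: power2_eq_square mult.commute)
  qed
  have first: "radial_bitension r = deriv (deriv x) r + deriv \<sigma> r / \<sigma> r * deriv x r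
      - (c\<^sup>2 + k\<^sup>2 / (\<sigma> r)\<^sup>2) * deriv ll (\<rho> r) * x r
      - (2 * c * deriv y r + (y r)\<^sup>2) * ll (\<rho> r)" if "r \<in> I" for r
    unfolding radial_bitension_def ll'[OF that] x_eq y_eq by (simp add: ll)
  have second: "c * angular_bitension r = c * deriv (deriv y) r + y r * deriv y r
      + 2 * c\<^sup>2 * deriv lam (\<rho> r) / lam (\<rho> r) * deriv x r
      + 2 * c\<^sup>2 * (deriv \<sigma> r * deriv lam (\<rho> r) / (\<sigma> r * lam (\<rho> r))
                  + deriv \<rho> r * deriv ll (\<rho> r) / (lam (\<rho> r))\<^sup>2) * x r" if "r \<in> I" for r
  proof -
    \<comment> \<open>With \<open>c\<close> pulled out of \<open>y\<close>, the term \<open>y y'\<close> is \<open>c\<close> times the first order term in \<open>y'\<close> of the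
      angular component.\<close>
    have "y r = c * (2 * deriv \<rho> r * deriv lam (\<rho> r) / lam (\<rho> r) + deriv \<sigma> r / \<sigma> r)"
      by (simp add: y algebra_simps)
    then show ?thesis
      unfolding angular_bitension_def ll'[OF that] x_eq[symmetric] y_eq[symmetric]
      by (simp add: algebra_simps power2_eq_square)
  qed
  show ?thesis
    using tension_eq biharmonic_iff first second by (simp add: x_eq y_eq)
qed

end
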